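(* Let $\mathcal{R}$ be a set of first-order rewrite rules with Leibniz representation $\Gamma_{\mathcal{R}}, \Delta_{\mathcal{R}}$. (1) If $C[t] \to C[t']$ by a rule $l \to r \in \mathcal{R}$ (where $C$ is a term context with exactly one hole), then $\Gamma_{\mathcal{R}} \vdash e : C[t'] \Rightarrow C[t]$ in $\mathbf{F}_2^\mu$ for some evidence $e$. (2) If $t_1 \to t_2 \to t_3$ is a reduction using $\mathcal{R}$, then $\Gamma_{\mathcal{R}} \vdash e : t_3 \Rightarrow t_1$ for some evidence $e$.
   Context: First-order terms: $t ::= x \mid F^n\,t_1\cdots t_n$ (function symbols $F$ of arity $n$, always fully applied). Term contexts $C ::= \bullet \mid x \mid F^n\,C_1\cdots C_n$; $C[t]$ denotes replacing the unique hole of $C$ by $t$. A rewrite rule is $l\to r$ with $l$ not a variable and $\mathrm{FV}(r)\subseteq\mathrm{FV}(l)$; $C[t]\to C[t']$ if some $l\to r\in\mathcal{R}$ and substitution $\sigma$ satisfy $\sigma l\equiv t$, $\sigma r\equiv t'$. First-order terms are read as types of $\mathbf{F}_2^\mu$ (function symbols as type constants, term variables as type variables of kind $*$). Leibniz representation: $\Gamma_{\mathcal{R}}$ contains $\kappa : \forall p.\forall \underline{x}.\, p\,r \Rightarrow p\,l$ for each $l\to r\in\mathcal{R}$, with $\kappa$ a fresh evidence constant, $\underline{x}$ the free variables of $l$, and $p$ of kind $*\Rightarrow *$; $\Delta_{\mathcal{R}}$ contains $F : *^n\Rightarrow *$ for each function symbol $F^n$ of $\mathcal{R}$. System $\mathbf{F}_2^\mu$: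 evidence $e ::= \alpha \mid \kappa \mid \lambda\alpha.e \mid e\,e' \mid \mu\alpha.e \mid e\,T \mid \lambda x.e$; types $T ::= F \mid x \mid \lambda x.T \mid \forall x{:}K.T \mid T\,T' \mid T \Rightarrow T'$ with term kinds $K ::= * \mid *\Rightarrow K$; typing rules: variables/constants typed by their declarations in $\Gamma$; (App) from $e_1:T'$ and $e_2:T'\Rightarrow T$ infer $e_2\,e_1:T$; (Lam) from $\Gamma,\alpha:T'\vdash e:T$ infer $\lambda\alpha.e:T'\Rightarrow T$; (Mu) from $\Gamma,\alpha:T\vdash e:T$ infer $\mu\alpha.e:T$; (Inst) from $e:\forall x{:}K.T$ infer $e\,T':[T'/x]T$; (Abs) from $e:T$, $x\notin\mathrm{FV}(\Gamma)$ infer $\lambda x.e:\forall x{:}K.T$; (Conv) types may be replaced by $\leftrightarrow_o^*$-equivalent ones, where $\to_o$ is the compatible closure of $(\lambda x.T)T'\to_o[T'/x]T$. All types must be well-kinded; types of kind $*\Rightarrow *$ are $\lambda$-abstractions $\lambda x.T$ in which $x$ occurs in $T$. *)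

theory Defs
  imports Main
begin

text \<open>First-order terms over a signature: \<open>Sig f = Some n\<close> declares the function symbol \<open>f\<close>
  with arity \<open>n\<close>.\<close>

datatype (tm_vars: 'v, 'f) tm = Var 'v | Fun 'f "('v, 'f) tm list"

fun wf_tm :: "('f \<rightharpoonup> nat) \<Rightarrow> ('v, 'f) tm \<Rightarrow> bool" where
  "wf_tm Sig (Var x) = True"
| "wf_tm Sig (Fun f ts) = (Sig f = Some (length ts) \<and> (\<forall>t\<in>set ts. wf_tm Sig t))"

fun subst_tm :: "('v \<Rightarrow> ('v, 'f) tm) \<Rightarrow> ('v, 'f) tm \<Rightarrow> ('v, 'f) tm" where
  "subst_tm \<sigma> (Var x) = \<sigma> x"
| "subst_tm \<sigma> (Fun f ts) = Fun f (map (subst_tm \<sigma>) ts)"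

text \<open>The grammar of contexts allows any number of holes; \<open>fill\<close> is used at \<open>holes C = 1\<close>.\<close>

datatype ('v, 'f) ctxt = Hole | CVar 'v | CFun 'f "('v, 'f) ctxt list"

fun holes :: "('v, 'f) ctxt \<Rightarrow> nat" where
  "holes Hole = 1"
| "holes (CVar x) = 0"
| "holes (CFun f Cs) = sum_list (map holes Cs)"

fun fill :: "('v, 'f) ctxt \<Rightarrow> ('v, 'f) tm \<Rightarrow> ('v, 'f) tm" where
  "fill Hole t = t"
| "fill (CVar x) t = Var x"
| "fill (CFun f Cs) t = Fun f (map (\<lambda>C. fill C t) Cs)"

type_synonym ('v, 'f) rule = "('v, 'f) tm \<times> ('v, 'f) tm"

definition wf_rules :: "('f \<rightharpoonup> nat) \<Rightarrow> ('v, 'f) rule set \<Rightarrow> bool" where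
  "wf_rules Sig R \<longleftrightarrow> (\<forall>(l, r)\<in>R. wf_tm Sig l \<and> wf_tm Sig r \<and>
     (\<forall>x. l \<noteq> Var x) \<and> tm_vars r \<subseteq> tm_vars l)"

inductive rewrite :: "('v, 'f) rule set \<Rightarrow> ('v, 'f) tm \<Rightarrow> ('v, 'f) tm \<Rightarrow> bool"
  for R where
  "\<lbrakk>(l, r) \<in> R; subst_tm \<sigma> l = t; subst_tm \<sigma> r = t'; holes C = 1\<rbrakk>
    \<Longrightarrow> rewrite R (fill C t) (fill C t')"

datatype kind = Star | KFun kind  \<comment> \<open>\<open>KFun K\<close> is \<open>* \<Rightarrow> K\<close>\<close>

text \<open>Types up to renaming of bound variables: free variables are names (\<open>TFree\<close>), bound ones are
  de Bruijn indices (\<open>TBnd\<close>) referring to the enclosing \<open>TLam\<close> and \<open>TAll\<close>.\<close>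

datatype (ty_fv: 'v, 'f) ty =
    TCon 'f
  | TFree 'v
  | TBnd nat
  | TLam "('v, 'f) ty"
  | TAll kind "('v, 'f) ty"
  | TApp "('v, 'f) ty" "('v, 'f) ty"
  | TImp "('v, 'f) ty" "('v, 'f) ty"

primrec lift :: "nat \<Rightarrow> ('v, 'f) ty \<Rightarrow> ('v, 'f) ty" where
  "lift k (TCon F) = TCon F"
| "lift k (TFree x) = TFree x"
| "lift k (TBnd i) = TBnd (if i < k then i else Suc i)"
| "lift k (TLam T) = TLam (lift (Suc k) T)"
| "lift k (TAll K T) = TAll K (lift (Suc k) T)"
| "lift k (TApp T T') = TApp (lift k T) (lift k T')"
| "lift k (TImp T T') = TImp (lift k T) (lift k T')"

text \<open>\<open>inst k U T\<close> removes the binder of index \<open>k\<close>, replacing that index by \<open>U\<close>.\<close>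

primrec inst :: "nat \<Rightarrow> ('v, 'f) ty \<Rightarrow> ('v, 'f) ty \<Rightarrow> ('v, 'f) ty" where
  "inst k U (TCon F) = TCon F"
| "inst k U (TFree x) = TFree x"
| "inst k U (TBnd i) = (if i < k then TBnd i else if i = k then U else TBnd (i - 1))"
| "inst k U (TLam T) = TLam (inst (Suc k) (lift 0 U) T)"
| "inst k U (TAll K T) = TAll K (inst (Suc k) (lift 0 U) T)"
| "inst k U (TApp T T') = TApp (inst k U T) (inst k U T')"
| "inst k U (TImp T T') = TImp (inst k U T) (inst k U T')"

text \<open>\<open>bind k x T\<close> turns the name \<open>x\<close> into the index \<open>k\<close> of a newly inserted binder, so that
  \<open>\<forall>x:K. T\<close> is \<open>TAll K (bind 0 x T)\<close>.\<close>

primrec bind :: "nat \<Rightarrow> 'v \<Rightarrow> ('v, 'f) ty \<Rightarrow> ('v, 'f) ty" where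
  "bind k x (TCon F) = TCon F"
| "bind k x (TFree y) = (if y = x then TBnd k else TFree y)"
| "bind k x (TBnd i) = TBnd (if i < k then i else Suc i)"
| "bind k x (TLam T) = TLam (bind (Suc k) x T)"
| "bind k x (TAll K T) = TAll K (bind (Suc k) x T)"
| "bind k x (TApp T T') = TApp (bind k x T) (bind k x T')"
| "bind k x (TImp T T') = TImp (bind k x T) (bind k x T')"

primrec occurs :: "nat \<Rightarrow> ('v, 'f) ty \<Rightarrow> bool" where
  "occurs k (TCon F) = False"
| "occurs k (TFree x) = False"
| "occurs k (TBnd i) = (i = k)"
| "occurs k (TLam T) = occurs (Suc k) T"
| "occurs k (TAll K T) = occurs (Suc k) T"
| "occurs k (TApp T T') = (occurs k T \<or> occurs k T')"
| "occurs k (TImp T T') = (occurs k T \<or> occurs k T')"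

inductive red_o :: "('v, 'f) ty \<Rightarrow> ('v, 'f) ty \<Rightarrow> bool" where
  beta: "red_o (TApp (TLam T) T') (inst 0 T' T)"
| lam: "red_o T S \<Longrightarrow> red_o (TLam T) (TLam S)"
| all: "red_o T S \<Longrightarrow> red_o (TAll K T) (TAll K S)"
| appL: "red_o T S \<Longrightarrow> red_o (TApp T T') (TApp S T')"
| appR: "red_o T S \<Longrightarrow> red_o (TApp T' T) (TApp T' S)"
| impL: "red_o T S \<Longrightarrow> red_o (TImp T T') (TImp S T')"
| impR: "red_o T S \<Longrightarrow> red_o (TImp T' T) (TImp T' S)"

text \<open>A kind context declares type constants (\<open>Inl\<close>) and free type variables (\<open>Inr\<close>);
  the list gives the kinds of the bound indices.\<close>

inductive has_kind ::
  "('f + 'v \<rightharpoonup> kind) \<Rightarrow> kind list \<Rightarrow> ('v, 'f) ty \<Rightarrow> kind \<Rightarrow> bool" for \<Delta> where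
  con: "\<Delta> (Inl F) = Some K \<Longrightarrow> has_kind \<Delta> \<Theta> (TCon F) K"
| free: "\<Delta> (Inr x) = Some K \<Longrightarrow> has_kind \<Delta> \<Theta> (TFree x) K"
| bnd: "i < length \<Theta> \<Longrightarrow> has_kind \<Delta> \<Theta> (TBnd i) (\<Theta> ! i)"
| lam: "\<lbrakk>has_kind \<Delta> (Star # \<Theta>) T K; occurs 0 T\<rbrakk> \<Longrightarrow> has_kind \<Delta> \<Theta> (TLam T) (KFun K)"
| all: "has_kind \<Delta> (K # \<Theta>) T Star \<Longrightarrow> has_kind \<Delta> \<Theta> (TAll K T) Star"
| app: "\<lbrakk>has_kind \<Delta> \<Theta> T (KFun K); has_kind \<Delta> \<Theta> T' Star\<rbrakk> \<Longrightarrow> has_kind \<Delta> \<Theta> (TApp T T') K"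
| imp: "\<lbrakk>has_kind \<Delta> \<Theta> T Star; has_kind \<Delta> \<Theta> T' Star\<rbrakk> \<Longrightarrow> has_kind \<Delta> \<Theta> (TImp T T') Star"

datatype ('v, 'f, 'c) ev =
    EVar nat
  | ECon 'c
  | ELam nat "('v, 'f, 'c) ev"
  | EApp "('v, 'f, 'c) ev" "('v, 'f, 'c) ev"
  | EMu nat "('v, 'f, 'c) ev"
  | EInst "('v, 'f, 'c) ev" "('v, 'f) ty"
  | EAbs 'v "('v, 'f, 'c) ev"

text \<open>A typing context declares evidence variables (\<open>Inl\<close>) and evidence constants (\<open>Inr\<close>).\<close>

definition ctx_fv :: "(nat + 'c \<rightharpoonup> ('v, 'f) ty) \<Rightarrow> 'v set" where
  "ctx_fv \<Gamma> = (\<Union>T\<in>ran \<Gamma>. ty_fv T)"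

definition wf_ctx :: "('f + 'v \<rightharpoonup> kind) \<Rightarrow> (nat + 'c \<rightharpoonup> ('v, 'f) ty) \<Rightarrow> bool" where
  "wf_ctx \<Delta> \<Gamma> \<longleftrightarrow> (\<forall>T\<in>ran \<Gamma>. has_kind \<Delta> [] T Star)"

inductive has_type ::
  "('f + 'v \<rightharpoonup> kind) \<Rightarrow> (nat + 'c \<rightharpoonup> ('v, 'f) ty) \<Rightarrow> ('v, 'f, 'c) ev \<Rightarrow> ('v, 'f) ty \<Rightarrow> bool" where
  Var: "\<lbrakk>wf_ctx \<Delta> \<Gamma>; \<Gamma> (Inl \<alpha>) = Some T\<rbrakk> \<Longrightarrow> has_type \<Delta> \<Gamma> (EVar \<alpha>) T"
| Con: "\<lbrakk>wf_ctx \<Delta> \<Gamma>; \<Gamma> (Inr c) = Some T\<rbrakk> \<Longrightarrow> has_type \<Delta> \<Gamma> (ECon c) T"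
| App: "\<lbrakk>has_type \<Delta> \<Gamma> e1 T'; has_type \<Delta> \<Gamma> e2 (TImp T' T)\<rbrakk> \<Longrightarrow> has_type \<Delta> \<Gamma> (EApp e2 e1) T"
| Lam: "\<lbrakk>has_kind \<Delta> [] T' Star; has_type \<Delta> (\<Gamma>(Inl \<alpha> \<mapsto> T')) e T\<rbrakk>
    \<Longrightarrow> has_type \<Delta> \<Gamma> (ELam \<alpha> e) (TImp T' T)"
| Mu: "\<lbrakk>has_kind \<Delta> [] T Star; has_type \<Delta> (\<Gamma>(Inl \<alpha> \<mapsto> T)) e T\<rbrakk> \<Longrightarrow> has_type \<Delta> \<Gamma> (EMu \<alpha> e) T"
| Inst: "\<lbrakk>has_type \<Delta> \<Gamma> e (TAll K T); has_kind \<Delta> [] T' K\<rbrakk>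
    \<Longrightarrow> has_type \<Delta> \<Gamma> (EInst e T') (inst 0 T' T)"
| Abs: "\<lbrakk>has_type (\<Delta>(Inr x \<mapsto> K)) \<Gamma> e T; x \<notin> ctx_fv \<Gamma>\<rbrakk>
    \<Longrightarrow> has_type \<Delta> \<Gamma> (EAbs x e) (TAll K (bind 0 x T))"
| Conv: "\<lbrakk>has_type \<Delta> \<Gamma> e T; equivclp red_o T T'; has_kind \<Delta> [] T' Star\<rbrakk>
    \<Longrightarrow> has_type \<Delta> \<Gamma> e T'"

fun ty_of :: "('v, 'f) tm \<Rightarrow> ('v, 'f) ty" where
  "ty_of (Var x) = TFree x"
| "ty_of (Fun f ts) = foldl TApp (TCon f) (map ty_of ts)"

fun var_occs :: "('v, 'f) tm \<Rightarrow> 'v list" where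
  "var_occs (Var x) = [x]"
| "var_occs (Fun f ts) = concat (map var_occs ts)"

definition all_stars :: "'v list \<Rightarrow> ('v, 'f) ty \<Rightarrow> ('v, 'f) ty" where
  "all_stars xs T = foldr (\<lambda>x S. TAll Star (bind 0 x S)) xs T"

text \<open>\<open>\<forall>p:*\<Rightarrow>*. \<forall>xs:*. p r \<Rightarrow> p l\<close>, with \<open>xs\<close> the variables of \<open>l\<close> without repetition. The
  innermost \<open>TBnd 0\<close> is \<open>p\<close>: \<open>bind\<close> shifts it past each quantifier over \<open>xs\<close>.\<close>

definition leibniz :: "('v, 'f) rule \<Rightarrow> ('v, 'f) ty" where
  "leibniz = (\<lambda>(l, r). TAll (KFun Star)
     (all_stars (remdups (var_occs l)) (TImp (TApp (TBnd 0) (ty_of r)) (TApp (TBnd 0) (ty_of l)))))"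

text \<open>\<open>\<kappa>\<close> names the evidence constants; distinct rules get distinct constants when \<open>\<kappa>\<close> is
  injective on \<open>R\<close>.\<close>

definition Gamma_of ::
  "(('v, 'f) rule \<Rightarrow> 'c) \<Rightarrow> ('v, 'f) rule set \<Rightarrow> (nat + 'c \<rightharpoonup> ('v, 'f) ty)" where
  "Gamma_of \<kappa> R n = (case n of
     Inl \<alpha> \<Rightarrow> None
   | Inr c \<Rightarrow> if c \<in> \<kappa> ` R then Some (leibniz (inv_into R \<kappa> c)) else None)"

text \<open>Besides the function symbols, all first-order variables are declared, at kind \<open>*\<close>, so that
  open terms are well-kinded.\<close>

definition Delta_of :: "('f \<rightharpoonup> nat) \<Rightarrow> ('f + 'v \<rightharpoonup> kind)" where
  "Delta_of Sig n = (case n of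
     Inl f \<Rightarrow> map_option (\<lambda>k. (KFun ^^ k) Star) (Sig f)
   | Inr x \<Rightarrow> Some Star)"

end

(* A derivation for C[l\<sigma>] \<rightarrow> C[r\<sigma>] instantiates \<kappa> at p := \<lambda>x. C[x] and at \<sigma>, and converts by
   two \<beta>-steps; well-kindedness of \<lambda>x. C[x] needs the hole of C to exist. For two steps the
   derivations are composed as \<lambda>\<alpha>. e1 (e2 \<alpha>). Evidence does not weaken freely, because Abs has
   an eigenvariable condition, so the one-step result is proved in every well-kinded context that
   contains the rule. *)
theory Submission
  imports Defs
begin

section \<open>First-order terms as types under an assignment to their variables\<close>

text \<open>The values of \<open>\<rho>\<close> may be names, bound indices or arbitrary types. Rule
  sides under quantifiers and their instances thus have one shape, and \<open>inst\<close> and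
  \<open>bind\<close> act on \<open>\<rho>\<close> alone.\<close>

fun ty_subst :: "('v \<Rightarrow> ('v, 'f) ty) \<Rightarrow> ('v, 'f) tm \<Rightarrow> ('v, 'f) ty" where
  "ty_subst \<rho> (Var x) = \<rho> x"
| "ty_subst \<rho> (Fun f ts) = foldl TApp (TCon f) (map (ty_subst \<rho>) ts)"

lemma ty_subst_cong:
  "(\<And>x. x \<in> tm_vars t \<Longrightarrow> \<rho> x = \<rho>' x) \<Longrightarrow> ty_subst \<rho> t = ty_subst \<rho>' t"
proof (induction t)
  case (Fun f ts)
  have "map (ty_subst \<rho>) ts = map (ty_subst \<rho>') ts"
    using Fun by auto
  then show ?case by (simp only: ty_subst.simps)
qed simp

lemma ty_of_eq_ty_subst: "ty_of t = ty_subst TFree t"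
  by (induction t) (simp_all cong: map_cong)

lemma ty_of_subst_tm: "ty_of (subst_tm \<sigma> t) = ty_subst (\<lambda>x. ty_of (\<sigma> x)) t"
  by (induction t) (simp_all add: comp_def cong: map_cong)

lemma set_var_occs: "set (var_occs t) = tm_vars t"
  by (induction t) auto

lemma inst_foldl_TApp:
  "inst k U (foldl TApp T Ts) = foldl TApp (inst k U T) (map (inst k U) Ts)"
  by (induction Ts arbitrary: T) simp_all

lemma bind_foldl_TApp:
  "bind k x (foldl TApp T Ts) = foldl TApp (bind k x T) (map (bind k x) Ts)"
  by (induction Ts arbitrary: T) simp_all

lemma occurs_foldl_TApp:
  "occurs k (foldl TApp T Ts) \<longleftrightarrow> occurs k T \<or> (\<exists>S\<in>set Ts. occurs k S)"
  by (induction Ts arbitrary: T) auto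

lemma inst_ty_subst: "inst k U (ty_subst \<rho> t) = ty_subst (\<lambda>x. inst k U (\<rho> x)) t"
  by (induction t) (simp_all add: inst_foldl_TApp comp_def cong: map_cong)

lemma bind_ty_subst: "bind k x (ty_subst \<rho> t) = ty_subst (\<lambda>y. bind k x (\<rho> y)) t"
  by (induction t) (simp_all add: bind_foldl_TApp comp_def cong: map_cong)

section \<open>Kinding of terms; closed types\<close>

lemma has_kind_foldl_TApp:
  assumes "has_kind \<Delta> \<Theta> T ((KFun ^^ length Ts) K)"
    and "\<And>S. S \<in> set Ts \<Longrightarrow> has_kind \<Delta> \<Theta> S Star"
  shows "has_kind \<Delta> \<Theta> (foldl TApp T Ts) K"
  using assms by (induction Ts arbitrary: T) (auto intro: has_kind.app)

lemma has_kind_TFree: "has_kind (Delta_of Sig) \<Theta> (TFree x) Star"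
  by (rule has_kind.free) (simp add: Delta_of_def)

lemma has_kind_TCon_app:
  assumes "Sig f = Some (length Ts)" "\<And>S. S \<in> set Ts \<Longrightarrow> has_kind (Delta_of Sig) \<Theta> S Star"
  shows "has_kind (Delta_of Sig) \<Theta> (foldl TApp (TCon f) Ts) Star"
  using assms by (intro has_kind_foldl_TApp has_kind.con) (simp_all add: Delta_of_def)

lemma has_kind_ty_subst:
  assumes "wf_tm Sig t" "\<And>x. has_kind (Delta_of Sig) \<Theta> (\<rho> x) Star"
  shows "has_kind (Delta_of Sig) \<Theta> (ty_subst \<rho> t) Star"
  using assms(1)
proof (induction t)
  case (Fun f ts)
  then show ?case unfolding ty_subst.simps by (intro has_kind_TCon_app) auto
qed (simp add: assms(2))

lemma has_kind_ty_of: "wf_tm Sig t \<Longrightarrow> has_kind (Delta_of Sig) \<Theta> (ty_of t) Star"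
  unfolding ty_of_eq_ty_subst by (rule has_kind_ty_subst[OF _ has_kind_TFree])

text \<open>The dangling indices of a well-kinded type point into \<open>\<Theta>\<close>, so an
  operation at index \<open>length \<Theta>\<close> or above meets none of them.\<close>

lemma has_kind_imp_closed:
  "has_kind \<Delta> \<Theta> T K \<Longrightarrow> length \<Theta> \<le> k \<Longrightarrow> lift k T = T \<and> inst k U T = T"
  by (induction arbitrary: k U rule: has_kind.induct) simp_all

text \<open>Closedness is expressed by the two invariances used later: \<open>U\<close> is not
  changed by lifting when \<open>inst\<close> carries it under quantifiers, nor by later
  instantiations.\<close>

definition closed_ty :: "('v, 'f) ty \<Rightarrow> bool" where
  "closed_ty T \<longleftrightarrow> (\<forall>k. lift k T = T) \<and> (\<forall>k U. inst k U T = T)"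

lemma has_kind_Nil_closed: "has_kind \<Delta> [] T K \<Longrightarrow> closed_ty T"
  using has_kind_imp_closed[of \<Delta> "[]"] unfolding closed_ty_def by auto

lemma closed_TFree: "closed_ty (TFree x)"
  by (simp add: closed_ty_def)

section \<open>Contexts as bodies of type abstractions\<close>

text \<open>This is the body of \<lambda>x. C[x]. Contexts contain no binders, so the hole has index
  0 at every depth.\<close>

fun ctxt_ty :: "('v, 'f) ctxt \<Rightarrow> ('v, 'f) ty" where
  "ctxt_ty Hole = TBnd 0"
| "ctxt_ty (CVar x) = TFree x"
| "ctxt_ty (CFun f Cs) = foldl TApp (TCon f) (map ctxt_ty Cs)"

lemma inst_ctxt_ty: "inst 0 (ty_of t) (ctxt_ty C) = ty_of (fill C t)"
  by (induction C) (simp_all add: inst_foldl_TApp comp_def cong: map_cong)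

lemma sum_list_nat_pos_iff: "0 < sum_list (ns :: nat list) \<longleftrightarrow> (\<exists>n\<in>set ns. 0 < n)"
  by (induction ns) auto

lemma occurs_ctxt_ty: "0 < holes C \<Longrightarrow> occurs 0 (ctxt_ty C)"
  by (induction C) (auto simp: occurs_foldl_TApp sum_list_nat_pos_iff)

text \<open>Filling preserves the lengths of argument lists, so one well-formed filling certifies
  the arities of all function symbols in \<open>C\<close>.\<close>

lemma has_kind_ctxt_ty:
  "wf_tm Sig (fill C t) \<Longrightarrow> has_kind (Delta_of Sig) (Star # \<Theta>) (ctxt_ty C) Star"
proof (induction C)
  case Hole
  show ?case using has_kind.bnd[of 0 "Star # \<Theta>"] by simp
next
  case (CVar x)
  show ?case by (simp add: has_kind_TFree)
next
  case (CFun f Cs)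
  then show ?case unfolding ctxt_ty.simps by (intro has_kind_TCon_app) auto
qed

section \<open>Well-formedness under filling and substitution\<close>

lemma wf_tm_fill_hole: "wf_tm Sig (fill C t) \<Longrightarrow> 0 < holes C \<Longrightarrow> wf_tm Sig t"
  by (induction C) (auto simp: sum_list_nat_pos_iff)

lemma wf_tm_fill_replace:
  "wf_tm Sig (fill C t) \<Longrightarrow> wf_tm Sig t' \<Longrightarrow> wf_tm Sig (fill C t')"
  by (induction C) auto

text \<open>A rewrite step does not require \<open>\<sigma>\<close> to be well-formed; on the
  variables of \<open>l\<close> this follows because their images are subterms of the redex.\<close>

lemma wf_tm_subst_var:
  "wf_tm Sig (subst_tm \<sigma> t) \<Longrightarrow> x \<in> tm_vars t \<Longrightarrow> wf_tm Sig (\<sigma> x)"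
  by (induction t) auto

lemma wf_tm_subst:
  "wf_tm Sig t \<Longrightarrow> (\<And>x. x \<in> tm_vars t \<Longrightarrow> wf_tm Sig (\<sigma> x)) \<Longrightarrow> wf_tm Sig (subst_tm \<sigma> t)"
  by (induction t) auto

section \<open>The Leibniz type in de Bruijn form\<close>

text \<open>A Leibniz type at an intermediate stage: \<open>n\<close> quantifiers over variables
  remain, \<open>\<rho>\<close> records what each variable of the rule currently stands for, and
  \<open>p\<close> is the current predicate.\<close>

definition leibniz_body ::
  "('v, 'f) rule \<Rightarrow> nat \<Rightarrow> ('v \<Rightarrow> ('v, 'f) ty) \<Rightarrow> ('v, 'f) ty \<Rightarrow> ('v, 'f) ty" where
  "leibniz_body lr n \<rho> p = (TAll Star ^^ n)
     (TImp (TApp p (ty_subst \<rho> (snd lr))) (TApp p (ty_subst \<rho> (fst lr))))"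

lemma bind_TAll_pow: "bind k x ((TAll K ^^ n) T) = (TAll K ^^ n) (bind (k + n) x T)"
  by (induction n arbitrary: k) simp_all

lemma inst_TAll_pow:
  "closed_ty U \<Longrightarrow> inst k U ((TAll K ^^ n) T) = (TAll K ^^ n) (inst (k + n) U T)"
  by (induction n arbitrary: k) (simp_all add: closed_ty_def)

lemma inst_leibniz_body:
  "closed_ty U \<Longrightarrow> inst 0 U (leibniz_body lr n \<rho> p)
    = leibniz_body lr n (\<lambda>x. inst n U (\<rho> x)) (inst n U p)"
  by (simp add: leibniz_body_def inst_TAll_pow inst_ty_subst)

text \<open>The first name in the list belongs to the outermost quantifier, hence has the largest index.\<close>

primrec index_vars :: "('v \<Rightarrow> ('v, 'f) ty) \<Rightarrow> 'v list \<Rightarrow> 'v \<Rightarrow> ('v, 'f) ty" where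
  "index_vars g [] = g"
| "index_vars g (x # xs) = (index_vars g xs)(x := TBnd (length xs))"

lemma index_vars_cases:
  "(\<exists>j<length xs. index_vars g xs y = TBnd j \<and> y \<in> set xs) \<or>
   index_vars g xs y = g y \<and> y \<notin> set xs"
  by (induction xs) (auto simp: less_Suc_eq)

text \<open>The new index \<open>length xs\<close> exceeds all indices assigned so far, so none of
  them is shifted.\<close>

lemma bind_index_vars:
  fixes x y :: 'v
  assumes "x \<notin> set xs"
  shows "bind (length xs) x (index_vars TFree xs y) = (index_vars TFree (x # xs) y :: ('v, 'f) ty)"
  using assms index_vars_cases[of xs "TFree :: 'v \<Rightarrow> ('v, 'f) ty" y] by auto

text \<open>Removing the outermost binder leaves the smaller indices alone, and the type argument
  becomes the default value of \<open>x\<close>. If \<open>x\<close> occurred again in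
  \<open>xs\<close>, that default would be masked.\<close>

lemma inst_index_vars:
  assumes "x \<notin> set xs" "\<And>y. closed_ty (g y)"
  shows "inst (length xs) U (index_vars g (x # xs) y) = index_vars (g(x := U)) xs y"
proof (cases "y = x")
  case True
  then show ?thesis using assms(1) index_vars_cases[of xs "g(x := U)" x] by auto
next
  case False
  have "index_vars (g(x := U)) xs y = index_vars g xs y"
    using False by (induction xs) auto
  then show ?thesis
    using False assms(2) index_vars_cases[of xs g y] by (auto simp: closed_ty_def)
qed

text \<open>Each \<open>bind 0 x\<close> acts at index \<open>length xs\<close> below the
  quantifiers already present; there it captures \<open>x\<close> and moves \<open>p\<close> up by
  one.\<close>

lemma all_stars_eq_leibniz_body:
  assumes "distinct xs"
  shows "all_stars xs (TImp (TApp (TBnd 0) (ty_of r)) (TApp (TBnd 0) (ty_of l)))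
    = leibniz_body (l, r) (length xs) (index_vars TFree xs) (TBnd (length xs))"
  using assms
proof (induction xs)
  case Nil
  show ?case by (simp add: all_stars_def leibniz_body_def ty_of_eq_ty_subst)
next
  case (Cons x xs)
  then have "all_stars (x # xs) (TImp (TApp (TBnd 0) (ty_of r)) (TApp (TBnd 0) (ty_of l)))
    = TAll Star (bind 0 x
        (leibniz_body (l, r) (length xs) (index_vars TFree xs) (TBnd (length xs))))"
    by (simp add: all_stars_def)
  also have "\<dots> = leibniz_body (l, r) (length (x # xs)) (index_vars TFree (x # xs))
      (TBnd (length (x # xs)))"
    using Cons.prems
    by (simp add: leibniz_body_def bind_TAll_pow bind_ty_subst bind_index_vars
        del: index_vars.simps)
  finally show ?case .
qed

lemma leibniz_eq_leibniz_body:
  "leibniz (l, r) = (let xs = remdups (var_occs l) in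
     TAll (KFun Star)
       (leibniz_body (l, r) (length xs) (index_vars TFree xs) (TBnd (length xs))))"
  by (simp add: leibniz_def all_stars_eq_leibniz_body Let_def)

lemma has_kind_TAll_pow:
  "has_kind \<Delta> (replicate n K @ \<Theta>) T Star \<Longrightarrow> has_kind \<Delta> \<Theta> ((TAll K ^^ n) T) Star"
proof (induction n arbitrary: \<Theta>)
  case (Suc n)
  have "has_kind \<Delta> (replicate n K @ K # \<Theta>) T Star"
    using Suc.prems by (simp add: replicate_app_Cons_same)
  then show ?case using Suc.IH by (simp add: has_kind.all)
qed simp

lemma has_kind_leibniz:
  fixes l r :: "('v, 'f) tm"
  assumes "wf_tm Sig l" "wf_tm Sig r"
  shows "has_kind (Delta_of Sig) [] (leibniz (l, r)) Star"
proof -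
  define xs where "xs = remdups (var_occs l)"
  \<comment> \<open>The inner indices belong to the variables of \<open>l\<close>; \<open>p\<close>,
    bound outermost, comes directly after them at index \<open>length xs\<close>.\<close>
  let ?\<Theta> = "replicate (length xs) Star @ [KFun Star]"
  have "has_kind (Delta_of Sig) ?\<Theta> (index_vars TFree xs y) Star" for y
    using index_vars_cases[of xs "TFree :: 'v \<Rightarrow> ('v, 'f) ty" y]
  proof (elim disjE exE conjE)
    fix j assume "j < length xs" "index_vars TFree xs y = (TBnd j :: ('v, 'f) ty)"
    then show ?thesis
      using has_kind.bnd[of j ?\<Theta> "Delta_of Sig"] by (simp add: nth_append)
  qed (simp add: has_kind_TFree)
  moreover have "has_kind (Delta_of Sig) ?\<Theta> (TBnd (length xs)) (KFun Star)"
    using has_kind.bnd[of "length xs" ?\<Theta> "Delta_of Sig"] by (simp add: nth_append)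
  ultimately show ?thesis
    unfolding leibniz_eq_leibniz_body Let_def leibniz_body_def xs_def[symmetric]
    by (auto intro!: has_kind.all has_kind_TAll_pow has_kind.imp has_kind.app
        has_kind_ty_subst assms)
qed

section \<open>Evidence for rewrite steps\<close>

text \<open>Quantifiers are instantiated from the outside in. Each one moves a type argument from
  the indexed names into \<open>g\<close>, so the induction must generalize over \<open>g\<close>;
  the arguments are closed, so later instantiations do not disturb them.\<close>

lemma has_type_inst_leibniz_body:
  assumes "distinct xs" "closed_ty p"
    and "\<And>y. closed_ty (g y)"
    and "\<And>x. x \<in> set xs \<Longrightarrow> has_kind \<Delta> [] (U x) Star"
    and "has_type \<Delta> \<Gamma> e (leibniz_body lr (length xs) (index_vars g xs) p)"
  shows "\<exists>e. has_type \<Delta> \<Gamma> e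
    (leibniz_body lr 0 (\<lambda>y. if y \<in> set xs then U y else g y) p)"
  using assms(1,3-)
proof (induction xs arbitrary: g e)
  case Nil
  then show ?case by auto
next
  case (Cons x xs)
  have kU: "has_kind \<Delta> [] (U x) Star" using Cons.prems by simp
  then have cU: "closed_ty (U x)" by (rule has_kind_Nil_closed)
  have "has_type \<Delta> \<Gamma> e
      (TAll Star (leibniz_body lr (length xs) (index_vars g (x # xs)) p))"
    using Cons.prems(4) by (simp add: leibniz_body_def del: index_vars.simps)
  from has_type.Inst[OF this kU]
  have step: "has_type \<Delta> \<Gamma> (EInst e (U x))
      (leibniz_body lr (length xs) (index_vars (g(x := U x)) xs) p)"
    using Cons.prems(1,2) cU assms(2) inst_index_vars[of x xs g "U x"]
    by (simp add: inst_leibniz_body closed_ty_def del: index_vars.simps)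
  have "\<exists>e. has_type \<Delta> \<Gamma> e
      (leibniz_body lr 0 (\<lambda>y. if y \<in> set xs then U y else (g(x := U x)) y) p)"
    by (rule Cons.IH[OF _ _ _ step]) (use Cons.prems cU in auto)
  moreover have "(\<lambda>y. if y \<in> set xs then U y else (g(x := U x)) y)
      = (\<lambda>y. if y \<in> set (x # xs) then U y else g y)"
    by auto
  ultimately show ?case by simp
qed

lemma equivclp_TImp_beta:
  "equivclp red_o (TImp (TApp (TLam T) A) (TApp (TLam T) B)) (TImp (inst 0 A T) (inst 0 B T))"
  by (rule equivclp_trans; rule r_into_equivclp, rule red_o.impL red_o.impR, rule red_o.beta)

lemma has_type_step:
  fixes l r :: "('v, 'f) tm"
  assumes rule: "wf_tm Sig r" "tm_vars r \<subseteq> tm_vars l"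
    and \<Gamma>: "wf_ctx (Delta_of Sig) \<Gamma>" "\<Gamma> (Inr c) = Some (leibniz (l, r))"
    and C: "0 < holes C" "wf_tm Sig (fill C (subst_tm \<sigma> l))"
  shows "\<exists>e. has_type (Delta_of Sig) \<Gamma> e
      (TImp (ty_of (fill C (subst_tm \<sigma> r))) (ty_of (fill C (subst_tm \<sigma> l))))"
proof -
  \<comment> \<open>As \<open>C\<close> has a hole, the redex is a subterm of the filled
    term.\<close>
  have wf\<sigma>: "wf_tm Sig (\<sigma> x)" if "x \<in> tm_vars l" for x
    using wf_tm_subst_var[OF wf_tm_fill_hole[OF C(2,1)] that] .
  then have "wf_tm Sig (subst_tm \<sigma> r)"
    using rule by (intro wf_tm_subst) auto
  then have wfr: "wf_tm Sig (fill C (subst_tm \<sigma> r))"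
    by (rule wf_tm_fill_replace[OF C(2)])
  define xs where "xs = remdups (var_occs l)"
  have set_xs: "set xs = tm_vars l" by (simp add: xs_def set_var_occs)
  define P where "P = TLam (ctxt_ty C)"
  have kP: "has_kind (Delta_of Sig) [] P (KFun Star)"
    unfolding P_def using has_kind_ctxt_ty[OF C(2)] occurs_ctxt_ty[OF C(1)]
    by (rule has_kind.lam)
  then have cP: "closed_ty P" by (rule has_kind_Nil_closed)
  let ?n = "length xs"
  have "has_type (Delta_of Sig) \<Gamma> (ECon c)
      (TAll (KFun Star) (leibniz_body (l, r) ?n (index_vars TFree xs) (TBnd ?n)))"
    using has_type.Con[OF \<Gamma>] by (simp add: leibniz_eq_leibniz_body Let_def xs_def)
  from has_type.Inst[OF this kP]
  have "has_type (Delta_of Sig) \<Gamma> (EInst (ECon c) P)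
      (leibniz_body (l, r) ?n (\<lambda>y. inst ?n P (index_vars TFree xs y)) P)"
    by (simp add: inst_leibniz_body cP)
  \<comment> \<open>The variables have indices below \<open>?n\<close>, the index of
    \<open>p\<close>, so instantiating \<open>p\<close> does not affect them.\<close>
  moreover have "(\<lambda>y. inst ?n P (index_vars TFree xs y)) = index_vars TFree xs"
  proof
    fix y
    show "inst ?n P (index_vars TFree xs y) = index_vars TFree xs y"
      using index_vars_cases[of xs "TFree :: 'v \<Rightarrow> ('v, 'f) ty" y] by auto
  qed
  ultimately have "has_type (Delta_of Sig) \<Gamma> (EInst (ECon c) P)
      (leibniz_body (l, r) ?n (index_vars TFree xs) P)"
    by simp
  moreover have "distinct xs" by (simp add: xs_def)
  moreover have "has_kind (Delta_of Sig) [] (ty_of (\<sigma> x)) Star" if "x \<in> set xs" for x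
    using that wf\<sigma> has_kind_ty_of set_xs by blast
  ultimately obtain e where "has_type (Delta_of Sig) \<Gamma> e
      (leibniz_body (l, r) 0 (\<lambda>y. if y \<in> set xs then ty_of (\<sigma> y) else TFree y) P)"
    using has_type_inst_leibniz_body[where g = TFree and U = "\<lambda>x. ty_of (\<sigma> x)"] cP closed_TFree
    by blast
  \<comment> \<open>The two assignments can differ only outside \<open>tm_vars l\<close>; the
    variable condition on rules makes this apply to \<open>r\<close> as well as to
    \<open>l\<close>.\<close>
  moreover have "ty_subst (\<lambda>y. if y \<in> set xs then ty_of (\<sigma> y) else TFree y) t
      = ty_of (subst_tm \<sigma> t)" if "tm_vars t \<subseteq> tm_vars l" for t
    unfolding ty_of_subst_tm using that by (intro ty_subst_cong) (auto simp: set_xs)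
  ultimately have "has_type (Delta_of Sig) \<Gamma> e
      (TImp (TApp P (ty_of (subst_tm \<sigma> r))) (TApp P (ty_of (subst_tm \<sigma> l))))"
    using rule(2) by (simp add: leibniz_body_def)
  then have "has_type (Delta_of Sig) \<Gamma> e
      (TImp (ty_of (fill C (subst_tm \<sigma> r))) (ty_of (fill C (subst_tm \<sigma> l))))"
    unfolding P_def inst_ctxt_ty[symmetric]
  proof (rule has_type.Conv[OF _ equivclp_TImp_beta])
    show "has_kind (Delta_of Sig) [] (TImp (inst 0 (ty_of (subst_tm \<sigma> r)) (ctxt_ty C))
        (inst 0 (ty_of (subst_tm \<sigma> l)) (ctxt_ty C))) Star"
      unfolding inst_ctxt_ty using wfr C(2) by (intro has_kind.imp has_kind_ty_of)
  qed
  then show "\<exists>e. has_type (Delta_of Sig) \<Gamma> e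
      (TImp (ty_of (fill C (subst_tm \<sigma> r))) (ty_of (fill C (subst_tm \<sigma> l))))" ..
qed

text \<open>Injectivity lets \<open>inv_into\<close> recover the very rule that a constant
  names.\<close>

lemma Gamma_of_rule: "inj_on \<kappa> R \<Longrightarrow> lr \<in> R \<Longrightarrow> Gamma_of \<kappa> R (Inr (\<kappa> lr)) = Some (leibniz lr)"
  by (simp add: Gamma_of_def)

lemma wf_ctx_Gamma_of:
  assumes "wf_rules Sig R"
  shows "wf_ctx (Delta_of Sig) (Gamma_of \<kappa> R)"
proof -
  have "\<exists>lr\<in>R. T = leibniz lr" if "T \<in> ran (Gamma_of \<kappa> R)" for T
  proof -
    from that obtain n where "Gamma_of \<kappa> R n = Some T" by (auto simp: ran_def)
    then show ?thesis
      by (cases n) (auto simp: Gamma_of_def split: if_splits intro!: bexI inv_into_into)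
  qed
  then show ?thesis
    using assms has_kind_leibniz unfolding wf_ctx_def wf_rules_def by fastforce
qed

lemma wf_ctx_upd:
  "wf_ctx \<Delta> \<Gamma> \<Longrightarrow> has_kind \<Delta> [] T Star \<Longrightarrow> wf_ctx \<Delta> (\<Gamma>(a \<mapsto> T))"
  unfolding wf_ctx_def by (auto simp: ran_def)

lemma has_type_rewrite:
  assumes "wf_rules Sig R" "rewrite R s t" "wf_tm Sig s" "wf_ctx (Delta_of Sig) \<Gamma>"
    and "\<And>lr. lr \<in> R \<Longrightarrow> \<Gamma> (Inr (\<kappa> lr)) = Some (leibniz lr)"
  shows "\<exists>e. has_type (Delta_of Sig) \<Gamma> e (TImp (ty_of t) (ty_of s))"
  using assms(2,1,3-)
proof cases
  case (1 l r \<sigma> u u' C)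
  then show ?thesis
    using assms has_type_step[of Sig r l \<Gamma> "\<kappa> (l, r)" C \<sigma>] by (auto simp: wf_rules_def)
qed

text \<open>In a two-step reduction only the first term is assumed well-formed. The second must be
  so for the next step to be typed, and the third for its type to have kind
  \<open>Star\<close>.\<close>

lemma wf_tm_rewrite:
  assumes "wf_rules Sig R" "rewrite R s t" "wf_tm Sig s"
  shows "wf_tm Sig t"
  using assms(2)
proof cases
  case (1 l r \<sigma> u u' C)
  then have "wf_tm Sig r" "tm_vars r \<subseteq> tm_vars l" using assms(1) by (auto simp: wf_rules_def)
  moreover have "wf_tm Sig (subst_tm \<sigma> l)" using 1 assms(3) wf_tm_fill_hole[of Sig C u] by simp
  ultimately have "wf_tm Sig (subst_tm \<sigma> r)" by (auto intro!: wf_tm_subst intro: wf_tm_subst_var)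
  then show ?thesis using 1 assms(3) wf_tm_fill_replace[of Sig C u u'] by simp
qed

theorem theorem18:
  fixes Sig :: "'f \<rightharpoonup> nat"
    and R :: "('v, 'f) rule set"
    and \<kappa> :: "('v, 'f) rule \<Rightarrow> 'c"
  assumes "wf_rules Sig R"
    and "inj_on \<kappa> R"
  shows "(\<forall>C t t' l r \<sigma>.
            holes C = 1 \<and> wf_tm Sig (fill C t) \<and>
            (l, r) \<in> R \<and> subst_tm \<sigma> l = t \<and> subst_tm \<sigma> r = t' \<longrightarrow>
            (\<exists>e. has_type (Delta_of Sig) (Gamma_of \<kappa> R) e
                   (TImp (ty_of (fill C t')) (ty_of (fill C t))))) \<and>
         (\<forall>t1 t2 t3.
            wf_tm Sig t1 \<and> rewrite R t1 t2 \<and> rewrite R t2 t3 \<longrightarrow>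
            (\<exists>e. has_type (Delta_of Sig) (Gamma_of \<kappa> R) e
                   (TImp (ty_of t3) (ty_of t1))))"
proof (intro conjI allI impI; elim conjE)
  note \<Gamma> = wf_ctx_Gamma_of[OF assms(1)] Gamma_of_rule[OF assms(2)]
  fix C :: "('v, 'f) ctxt" and t t' l r \<sigma>
  assume *: "holes C = 1" "wf_tm Sig (fill C t)" "(l, r) \<in> R"
    "subst_tm \<sigma> l = t" "subst_tm \<sigma> r = t'"
  show "\<exists>e. has_type (Delta_of Sig) (Gamma_of \<kappa> R) e
      (TImp (ty_of (fill C t')) (ty_of (fill C t)))"
    by (rule has_type_rewrite[OF assms(1) rewrite.intros[OF *(3-5,1)] *(2) \<Gamma>])
next
  fix t1 t2 t3 :: "('v, 'f) tm"
  assume t1: "wf_tm Sig t1" and r12: "rewrite R t1 t2" and r23: "rewrite R t2 t3"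
  have t2: "wf_tm Sig t2" using wf_tm_rewrite[OF assms(1) r12 t1] .
  have k3: "has_kind (Delta_of Sig) [] (ty_of t3) Star"
    using wf_tm_rewrite[OF assms(1) r23 t2] by (rule has_kind_ty_of)
  \<comment> \<open>Evidence variable 0 serves as \<alpha>. Only an \<open>Inl\<close> entry is
    added, so the constants of the rules keep their types.\<close>
  let ?\<Gamma> = "(Gamma_of \<kappa> R)(Inl 0 \<mapsto> ty_of t3)"
  have \<Gamma>: "wf_ctx (Delta_of Sig) ?\<Gamma>"
    by (rule wf_ctx_upd[OF wf_ctx_Gamma_of[OF assms(1)] k3])
  have rules: "?\<Gamma> (Inr (\<kappa> lr)) = Some (leibniz lr)" if "lr \<in> R" for lr
    using Gamma_of_rule[OF assms(2) that] by simp
  obtain e1 where e1: "has_type (Delta_of Sig) ?\<Gamma> e1 (TImp (ty_of t2) (ty_of t1))"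
    using has_type_rewrite[OF assms(1) r12 t1 \<Gamma> rules] by blast
  obtain e2 where e2: "has_type (Delta_of Sig) ?\<Gamma> e2 (TImp (ty_of t3) (ty_of t2))"
    using has_type_rewrite[OF assms(1) r23 t2 \<Gamma> rules] by blast
  have "has_type (Delta_of Sig) ?\<Gamma> (EVar 0) (ty_of t3)"
    by (rule has_type.Var[OF \<Gamma>]) simp
  from has_type.Lam[OF k3 has_type.App[OF has_type.App[OF this e2] e1]]
  show "\<exists>e. has_type (Delta_of Sig) (Gamma_of \<kappa> R) e (TImp (ty_of t3) (ty_of t1))" ..
qed

end
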